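(* For $a\in(0,1)$ let $\mathcal E_a$ be the set of $b\in[0,1)$ such that the rotation number $\rho(a,b)$ is irrational. Then for every $a\in(0,1)$, the Hausdorff dimension of $\mathcal E_a$ is $0$. Moreover, the Hausdorff measure satisfies $\mathcal H_h(\mathcal E_a)<\infty$ for the gauge function $h(t)=1/|\log t|^2$, but $\mathcal H_h(\mathcal E_a)>0$ for the gauge function $h(t)=1/|\log t|$.
   Context: For $0<a<1$, $0\le b<1$, consider the multi-valued map $f_\pm$ on $[0,1]$, $x\mapsto\{f_-(x),f_+(x)\}$ with $f_-(x)=\{ax+b\}$ and $f_+(x)=\{ax+b\}_+$, where $\{x\}:=x-\lfloor x\rfloor$ and $\{x\}_+:=1-\{-x\}$. Let $F_-(x):=ax+b+(1-a)\lfloor x\rfloor$ and $F_+(x):=ax+b-(1-a)\lfloor 1-x\rfloor$ for $x\in\mathbb R$. The rotation number $\rho(a,b)\in[0,1)$ of $f_\pm$ is the number such that $F_-^n(x)/n\to\rho(a,b)$ and $F_+^n(x)/n\to\rho(a,b)$ as $n\to\infty$ for every $x\in\mathbb R$ (the limits exist, coincide and do not depend on $x$). For a gauge function $h$ (increasing, defined for small $t>0$, with $h(t)\to0$ as $t\to0$; set $h(0)=0$), $\mathcal H_h(E):=\lim_{\delta\to0}\inf\{\sum_k h(\operatorname{diam} U_k): E\subseteq\bigcup_k U_k,\ \operatorname{diam}U_k\le\delta\}$, the infimum over countable covers. *)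

theory Defs
  imports "HOL-Analysis.Analysis"
begin

text \<open>The two lifts to the real line of the branches of the multi-valued map
  x |-> {frac (a x + b), 1 - frac (- (a x + b))}.\<close>

definition F_minus :: "real \<Rightarrow> real \<Rightarrow> real \<Rightarrow> real" where
  "F_minus a b x = a * x + b + (1 - a) * of_int \<lfloor>x\<rfloor>"

definition F_plus :: "real \<Rightarrow> real \<Rightarrow> real \<Rightarrow> real" where
  "F_plus a b x = a * x + b - (1 - a) * of_int \<lfloor>1 - x\<rfloor>"

definition rotation_number :: "real \<Rightarrow> real \<Rightarrow> real" where
  "rotation_number a b =
     (THE r. 0 \<le> r \<and> r < 1 \<and>
        (\<forall>x. (\<lambda>n. (F_minus a b ^^ n) x / real n) \<longlonglongrightarrow> r) \<and>
        (\<forall>x. (\<lambda>n. (F_plus a b ^^ n) x / real n) \<longlonglongrightarrow> r))"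

definition irrational_rotation_set :: "real \<Rightarrow> real set" where
  "irrational_rotation_set a = {b. 0 \<le> b \<and> b < 1 \<and> rotation_number a b \<notin> \<rat>}"

text \<open>A gauge is only meaningful for small positive arguments, and its value at 0 is
  taken to be 0 whatever the given function returns there. The covering sets are required
  to be bounded because \<^const>\<open>diameter\<close> is unspecified on unbounded sets.
  Finite covers are included, by padding with empty sets.\<close>

definition hausdorff_content ::
    "(real \<Rightarrow> real) \<Rightarrow> real \<Rightarrow> 'a::metric_space set \<Rightarrow> ennreal" where
  "hausdorff_content h \<delta> E =
     Inf {(\<Sum>k. if diameter (U k) = 0 then 0 else ennreal (h (diameter (U k)))) | U :: nat \<Rightarrow> 'a set.
            E \<subseteq> (\<Union>k. U k) \<and> (\<forall>k. bounded (U k) \<and> diameter (U k) \<le> \<delta>)}"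

definition hausdorff_measure :: "(real \<Rightarrow> real) \<Rightarrow> 'a::metric_space set \<Rightarrow> ennreal" where
  "hausdorff_measure h E = Lim (at_right 0) (\<lambda>\<delta>. hausdorff_content h \<delta> E)"

text \<open>Only s > 0 is considered since t powr 0 is not a gauge; this does not
  affect the infimum.\<close>

definition hausdorff_dim :: "'a::metric_space set \<Rightarrow> ennreal" where
  "hausdorff_dim E =
     Inf {ennreal s | s. s > 0 \<and> hausdorff_measure (\<lambda>t. t powr s) E = 0}"

end

theory Submission
  imports Defs "HOL-Real_Asymp.Real_Asymp"
begin

text \<open>For every real \<open>r\<close> put \<open>B r = (1 - a)\<^sup>2 (\<Sum>k. a\<^sup>k \<lceil>(k+1) r\<rceil>)\<close>. The Hecke-Mahler series
  \<open>\<phi> \<theta> = (1 - a) (\<Sum>k. a\<^sup>k (\<lfloor>\<theta> - (k+1) r\<rfloor> + \<lceil>(k+1) r\<rceil>))\<close> solves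
  \<open>\<phi> (\<theta> + r) = a \<phi> \<theta> + B r + (1 - a) \<lfloor>\<theta>\<rfloor>\<close>, so comparing orbits with \<open>\<phi>\<close> gives rotation number at
  least \<open>r\<close> for \<open>b \<ge> B r\<close> and at most \<open>r\<close> for \<open>b \<le> B r\<close>. As \<open>B\<close> is strictly increasing,
  left-continuous, and continuous at irrational points, the exceptional set is the image under \<open>B\<close>
  of the irrationals in \<open>[0, 1)\<close>.

  If \<open>\<lceil>j r\<rceil> = \<lceil>j s\<rceil>\<close> for all \<open>j \<le> n\<close>, then \<open>B r\<close> and \<open>B s\<close> differ by at most \<open>(n+1) a\<^sup>n\<close>. Hence
  \<open>O(n\<^sup>2)\<close> sets of that diameter cover the exceptional set, which gives the upper bounds.
  Conversely, \<open>s - r \<ge> 1/N\<close> makes \<open>\<lceil>N s\<rceil>\<close> exceed \<open>\<lceil>N r\<rceil>\<close>, whence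
  \<open>B s - B r \<ge> (1 - a)\<^sup>2 a\<^bsup>1/(s - r)\<^esup>\<close>; so sets of diameter \<open>t\<close> have preimages of diameter
  \<open>O(1/|ln t|)\<close>, while all preimages together must cover Lebesgue measure 1.\<close>

section \<open>The parameter with a given rotation number\<close>

text \<open>The ceilings select the left end of the interval of parameters with rotation number
  \<open>r\<close>. The factor \<open>(1 - a)\<^sup>2\<close> normalises the value at 1 to
  1.\<close>

definition rot_param :: "real \<Rightarrow> real \<Rightarrow> real" where
  "rot_param a r = (1 - a)\<^sup>2 * (\<Sum>k. a ^ k * of_int \<lceil>real (Suc k) * r\<rceil>)"

definition semiconj :: "real \<Rightarrow> real \<Rightarrow> real \<Rightarrow> real" where
  "semiconj a r \<theta> =
     (1 - a) * (\<Sum>k. a ^ k * of_int (\<lfloor>\<theta> - real (Suc k) * r\<rfloor> + \<lceil>real (Suc k) * r\<rceil>))"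

section \<open>Convergence of the series and the functional equation\<close>

lemma summable_power_mult_linear:
  fixes a C :: real
  assumes "0 < a" "a < 1" and "\<And>k. \<bar>f k\<bar> \<le> C * real (Suc k)"
  shows "summable (\<lambda>k. a ^ k * f k)"
proof (rule summable_comparison_test')
  show "summable (\<lambda>k. C * (of_nat (Suc k) * a ^ k))"
    using geometric_deriv_sums[of a] assms(1,2) by (intro summable_mult) (auto simp: sums_iff)
next
  fix k :: nat
  have "norm (a ^ k * f k) = a ^ k * \<bar>f k\<bar>"
    using assms(1) by (simp add: abs_mult)
  also have "\<dots> \<le> a ^ k * (C * real (Suc k))"
    using assms by (intro mult_left_mono) auto
  finally show "norm (a ^ k * f k) \<le> C * (of_nat (Suc k) * a ^ k)"
    by (simp add: algebra_simps)
qed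

lemma bounded_deviation_tendsto:
  fixes u :: "nat \<Rightarrow> real"
  assumes "\<And>n. real n * r - C \<le> u n" "\<And>n. u n \<le> real n * r + C"
  shows "(\<lambda>n. u n / real n) \<longlonglongrightarrow> r"
proof (rule tendsto_sandwich)
  show "\<forall>\<^sub>F n in sequentially. r - C / real n \<le> u n / real n"
    using eventually_gt_at_top[of 0]
  proof eventually_elim
    case (elim n)
    have "(real n * r - C) / real n \<le> u n / real n"
      using assms(1) by (rule divide_right_mono) simp
    with elim show ?case by (simp add: diff_divide_distrib)
  qed
  show "\<forall>\<^sub>F n in sequentially. u n / real n \<le> r + C / real n"
    using eventually_gt_at_top[of 0]
  proof eventually_elim
    case (elim n)
    have "u n / real n \<le> (real n * r + C) / real n"
      using assms(2) by (rule divide_right_mono) simp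
    with elim show ?case by (simp add: add_divide_distrib)
  qed
qed real_asymp+

context
  fixes a :: real
  assumes a0: "0 < a" and a1: "a < 1"
begin

lemma summable_ceiling: "summable (\<lambda>k. a ^ k * of_int \<lceil>real (Suc k) * r\<rceil>)"
proof (rule summable_power_mult_linear[OF a0 a1])
  fix k :: nat
  have "\<bar>of_int \<lceil>real (Suc k) * r\<rceil>\<bar> \<le> \<bar>real (Suc k) * r\<bar> + (1::real)"
    by linarith
  also have "\<dots> \<le> (\<bar>r\<bar> + 1) * real (Suc k)"
    by (simp add: abs_mult distrib_left distrib_right del: of_nat_Suc)
  finally show "\<bar>of_int \<lceil>real (Suc k) * r\<rceil>\<bar> \<le> (\<bar>r\<bar> + 1) * real (Suc k)" .
qed

lemma summable_floor: "summable (\<lambda>k. a ^ k * of_int \<lfloor>\<theta> - real (Suc k) * r\<rfloor>)"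
proof (rule summable_power_mult_linear[OF a0 a1])
  fix k :: nat
  have "\<bar>of_int \<lfloor>\<theta> - real (Suc k) * r\<rfloor>\<bar> \<le> \<bar>real (Suc k) * r\<bar> + (\<bar>\<theta>\<bar> + 1::real)"
    by linarith
  also have "\<dots> \<le> \<bar>real (Suc k) * r\<bar> + (\<bar>\<theta>\<bar> + 1) * real (Suc k)"
    by (simp add: algebra_simps)
  also have "\<dots> = (\<bar>r\<bar> + \<bar>\<theta>\<bar> + 1) * real (Suc k)"
    by (simp add: abs_mult algebra_simps del: of_nat_Suc)
  finally show "\<bar>of_int \<lfloor>\<theta> - real (Suc k) * r\<rfloor>\<bar> \<le> (\<bar>r\<bar> + \<bar>\<theta>\<bar> + 1) * real (Suc k)" .
qed

lemma semiconj_eq: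
  "semiconj a r \<theta> = (1 - a) * ((\<Sum>k. a ^ k * of_int \<lfloor>\<theta> - real (Suc k) * r\<rfloor>)
     + (\<Sum>k. a ^ k * of_int \<lceil>real (Suc k) * r\<rceil>))"
  unfolding semiconj_def
  by (subst suminf_add[OF summable_floor summable_ceiling]) (simp add: algebra_simps)

text \<open>Splitting off \<open>k = 0\<close> from the floor series at \<open>\<theta> + r\<close>
  leaves \<lfloor>\<theta>\<rfloor> and \<open>a\<close> times the series at \<theta>. The ceiling
  series has factor \<open>1 - a\<close> on the left and \<open>a * (1 - a)\<close> on the right;
  the difference is \<open>rot_param a r\<close>.\<close>

lemma semiconj_add:
  "semiconj a r (\<theta> + r) = a * semiconj a r \<theta> + rot_param a r + (1 - a) * of_int \<lfloor>\<theta>\<rfloor>"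
proof -
  have "(\<Sum>k. a ^ k * of_int \<lfloor>\<theta> + r - real (Suc k) * r\<rfloor>)
      = of_int \<lfloor>\<theta>\<rfloor> + (\<Sum>k. a ^ Suc k * of_int \<lfloor>\<theta> + r - real (Suc (Suc k)) * r\<rfloor>)"
    by (subst suminf_split_head[OF summable_floor]) simp
  also have "(\<Sum>k. a ^ Suc k * of_int \<lfloor>\<theta> + r - real (Suc (Suc k)) * r\<rfloor>)
      = (\<Sum>k. a * (a ^ k * of_int \<lfloor>\<theta> - real (Suc k) * r\<rfloor>))"
    by (intro suminf_cong) (simp add: algebra_simps)
  also have "\<dots> = a * (\<Sum>k. a ^ k * of_int \<lfloor>\<theta> - real (Suc k) * r\<rfloor>)"
    by (rule suminf_mult[OF summable_floor])
  finally show ?thesis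
    by (simp add: semiconj_eq rot_param_def power2_eq_square algebra_simps)
qed

text \<open>The weights \<open>(1 - a) * a ^ k\<close> sum to 1, so \<open>semiconj\<close> is an
  average of integers, each between the floor and the ceiling of \<theta>.\<close>

lemma semiconj_bounds: "of_int \<lfloor>\<theta>\<rfloor> \<le> semiconj a r \<theta>" "semiconj a r \<theta> \<le> of_int \<lceil>\<theta>\<rceil>"
proof -
  let ?f = "\<lambda>k. \<lfloor>\<theta> - real (Suc k) * r\<rfloor> + \<lceil>real (Suc k) * r\<rceil>"
  have const: "(\<lambda>k. a ^ k * c) sums (c / (1 - a))" for c
    using sums_mult2[OF geometric_sums[of a], of c] a0 a1 by simp
  have sm: "summable (\<lambda>k. a ^ k * of_int (?f k))"
    using summable_add[OF summable_floor summable_ceiling] by (simp add: algebra_simps)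
  \<comment> \<open>The summand equals \<lfloor>\<theta> + u\<rfloor> with u = \<lceil>(k + 1)
    r\<rceil> - (k + 1) r in [0, 1).\<close>
  have lo: "\<lfloor>\<theta>\<rfloor> \<le> ?f k" and hi: "?f k \<le> \<lceil>\<theta>\<rceil>" for k
    by linarith+
  have "of_int \<lfloor>\<theta>\<rfloor> / (1 - a) \<le> (\<Sum>k. a ^ k * of_int (?f k))"
    unfolding sums_unique[OF const]
    using a0 lo by (intro suminf_le sm sums_summable[OF const] mult_left_mono of_int_le_iff[THEN iffD2]) auto
  then show "of_int \<lfloor>\<theta>\<rfloor> \<le> semiconj a r \<theta>"
    using a1 by (simp add: semiconj_def field_simps)
  have "(\<Sum>k. a ^ k * of_int (?f k)) \<le> of_int \<lceil>\<theta>\<rceil> / (1 - a)"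
    unfolding sums_unique[OF const]
    using a0 hi by (intro suminf_le sm sums_summable[OF const] mult_left_mono of_int_le_iff[THEN iffD2]) auto
  then show "semiconj a r \<theta> \<le> of_int \<lceil>\<theta>\<rceil>"
    using a1 by (simp add: semiconj_def field_simps)
qed

section \<open>Comparison of orbits of the two lifts\<close>

lemma F_minus_mono: "x \<le> y \<Longrightarrow> F_minus a b x \<le> F_minus a b y"
  unfolding F_minus_def using a0 a1 by (intro add_mono mult_left_mono) (auto intro: floor_mono)

lemma F_plus_mono: "x \<le> y \<Longrightarrow> F_plus a b x \<le> F_plus a b y"
  unfolding F_plus_def using a0 a1
  by (intro add_mono diff_mono mult_left_mono) (auto intro: floor_mono)

text \<open>As \<open>- \<lfloor>1 - y\<rfloor>\<close> is \<lceil>y\<rceil> - 1,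
  \<open>F_plus\<close> never exceeds \<open>F_minus\<close> at the same point. A strict shift of
  the argument reverses this order, so lower bounds for \<open>F_minus\<close> and upper bounds for
  \<open>F_plus\<close> control both maps.\<close>

lemma F_minus_less_F_plus:
  assumes "x < y"
  shows "F_minus a b x < F_plus a b y"
proof -
  have "a * x < a * y" using assms a0 by simp
  moreover have "(1 - a) * of_int \<lfloor>x\<rfloor> \<le> (1 - a) * of_int (- \<lfloor>1 - y\<rfloor>)"
    using a1 assms by (intro mult_left_mono of_int_le_iff[THEN iffD2]) linarith+
  ultimately show ?thesis
    by (simp add: F_minus_def F_plus_def)
qed

lemma funpow_F_minus_mono: "x \<le> y \<Longrightarrow> (F_minus a b ^^ n) x \<le> (F_minus a b ^^ n) y"
  by (induction n) (auto intro: F_minus_mono)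

lemma funpow_F_plus_mono: "x \<le> y \<Longrightarrow> (F_plus a b ^^ n) x \<le> (F_plus a b ^^ n) y"
  by (induction n) (auto intro: F_plus_mono)

lemma funpow_F_minus_less_F_plus: "x < y \<Longrightarrow> (F_minus a b ^^ n) x < (F_plus a b ^^ n) y"
  by (induction n) (auto intro: F_minus_less_F_plus)

lemma funpow_F_minus_of_int: "(F_minus a b ^^ n) (of_int m) = (F_minus a b ^^ n) 0 + of_int m"
  by (induction n) (auto simp: F_minus_def algebra_simps)

lemma F_plus_add_of_int: "F_plus a b (x + of_int m) = F_plus a b x + of_int m"
proof -
  have *: "\<lfloor>1 - (x + of_int m)\<rfloor> = \<lfloor>1 - x\<rfloor> - m"
    by linarith
  show ?thesis
    unfolding F_plus_def * by (simp add: algebra_simps)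
qed

lemma funpow_F_plus_of_int: "(F_plus a b ^^ n) (of_int m) = (F_plus a b ^^ n) 0 + of_int m"
  by (induction n) (auto simp: F_plus_add_of_int)

text \<open>The functional equation has \<lfloor>\<theta>\<rfloor> where \<open>F_minus\<close>
  takes the floor of the value of \<open>semiconj\<close>, which is no smaller. Hence
  \<open>F_minus\<close> moves that value at least as far as the rotation by \<open>r\<close>
  does.\<close>

lemma semiconj_le_funpow_F_minus:
  assumes "rot_param a r \<le> b"
  shows "semiconj a r (real n * r) \<le> (F_minus a b ^^ n) 0"
proof (induction n)
  case 0
  show ?case using semiconj_bounds(1)[of 0 r] semiconj_bounds(2)[of r 0] by simp
next
  case (Suc n)
  let ?s = "semiconj a r (real n * r)"
  have "\<lfloor>real n * r\<rfloor> \<le> \<lfloor>?s\<rfloor>"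
    using semiconj_bounds(1)[of "real n * r" r] by (simp add: le_floor_iff)
  then have "(1 - a) * of_int \<lfloor>real n * r\<rfloor> \<le> (1 - a) * of_int \<lfloor>?s\<rfloor>"
    using a1 by (intro mult_left_mono) auto
  then have "semiconj a r (real n * r + r) \<le> F_minus a b ?s"
    using assms unfolding semiconj_add F_minus_def by linarith
  also have "\<dots> \<le> F_minus a b ((F_minus a b ^^ n) 0)"
    using Suc by (rule F_minus_mono)
  finally show ?case
    by (simp add: algebra_simps)
qed

lemma funpow_F_plus_le_semiconj:
  assumes "b \<le> rot_param a r"
  shows "(F_plus a b ^^ n) 0 \<le> semiconj a r (real n * r)"
proof (induction n)
  case 0
  show ?case using semiconj_bounds(1)[of 0 r] semiconj_bounds(2)[of r 0] by simp
next
  case (Suc n)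
  let ?s = "semiconj a r (real n * r)"
  \<comment> \<open>The integer part used by \<open>F_plus\<close> is \<lceil>?s\<rceil> - 1; this
    offset absorbs the possible gap between ceiling and floor of \<open>real n * r\<close>.\<close>
  have "\<lceil>real n * r\<rceil> \<le> \<lfloor>real n * r\<rfloor> + 1"
    by linarith
  then have "?s \<le> of_int (\<lfloor>real n * r\<rfloor> + 1)"
    using semiconj_bounds(2)[of r "real n * r"] by linarith
  then have "- \<lfloor>1 - ?s\<rfloor> \<le> \<lfloor>real n * r\<rfloor>"
    by linarith
  then have "(1 - a) * of_int (- \<lfloor>1 - ?s\<rfloor>) \<le> (1 - a) * of_int \<lfloor>real n * r\<rfloor>"
    using a1 by (intro mult_left_mono of_int_le_iff[THEN iffD2]) auto
  then have "F_plus a b ?s \<le> semiconj a r (real n * r + r)"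
    using assms unfolding semiconj_add F_plus_def by simp
  moreover have "F_plus a b ((F_plus a b ^^ n) 0) \<le> F_plus a b ?s"
    using Suc by (rule F_plus_mono)
  ultimately show ?case
    by (simp add: algebra_simps)
qed

lemma funpow_F_minus_ge:
  assumes "rot_param a r \<le> b"
  shows "real n * r - 1 \<le> (F_minus a b ^^ n) 0"
  using semiconj_le_funpow_F_minus[OF assms, of n] semiconj_bounds(1)[of "real n * r" r]
  by linarith

lemma funpow_F_plus_le:
  assumes "b \<le> rot_param a r"
  shows "(F_plus a b ^^ n) 0 \<le> real n * r + 1"
  using funpow_F_plus_le_semiconj[OF assms, of n] semiconj_bounds(2)[of r "real n * r"]
  by linarith

text \<open>Monotonicity and integer translations carry the two one-sided bounds from the orbit of 0
  to every orbit of both lifts.\<close>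

lemma rotation_number_eqI:
  assumes r: "0 \<le> r" "r < 1"
    and lo: "\<And>n. real n * r - 1 \<le> (F_minus a b ^^ n) 0"
    and hi: "\<And>n. (F_plus a b ^^ n) 0 \<le> real n * r + 1"
  shows "rotation_number a b = r"
proof -
  \<comment> \<open>The 3 is the deviation 1 at the orbit of 0 plus a shift by at most 2 from
    \<lfloor>x\<rfloor> to a comparison integer.\<close>
  have *: "real n * r - (\<bar>of_int \<lfloor>x\<rfloor>\<bar> + 3) \<le> (F_minus a b ^^ n) x"
    "(F_minus a b ^^ n) x \<le> real n * r + (\<bar>of_int \<lfloor>x\<rfloor>\<bar> + 3)"
    "real n * r - (\<bar>of_int \<lfloor>x\<rfloor>\<bar> + 3) \<le> (F_plus a b ^^ n) x"
    "(F_plus a b ^^ n) x \<le> real n * r + (\<bar>of_int \<lfloor>x\<rfloor>\<bar> + 3)" for n x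
  proof -
    have "(F_minus a b ^^ n) (of_int \<lfloor>x\<rfloor>) \<le> (F_minus a b ^^ n) x"
      by (rule funpow_F_minus_mono) simp
    then show "real n * r - (\<bar>of_int \<lfloor>x\<rfloor>\<bar> + 3) \<le> (F_minus a b ^^ n) x"
      using lo[of n] unfolding funpow_F_minus_of_int by linarith
    have "(F_minus a b ^^ n) x < (F_plus a b ^^ n) (of_int (\<lfloor>x\<rfloor> + 2))"
      by (rule funpow_F_minus_less_F_plus) linarith
    then show "(F_minus a b ^^ n) x \<le> real n * r + (\<bar>of_int \<lfloor>x\<rfloor>\<bar> + 3)"
      using hi[of n] unfolding funpow_F_plus_of_int by simp
    have "(F_minus a b ^^ n) (of_int (\<lfloor>x\<rfloor> - 1)) < (F_plus a b ^^ n) x"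
      by (rule funpow_F_minus_less_F_plus) linarith
    then show "real n * r - (\<bar>of_int \<lfloor>x\<rfloor>\<bar> + 3) \<le> (F_plus a b ^^ n) x"
      using lo[of n] unfolding funpow_F_minus_of_int by simp
    have "(F_plus a b ^^ n) x \<le> (F_plus a b ^^ n) (of_int (\<lfloor>x\<rfloor> + 1))"
      by (rule funpow_F_plus_mono) linarith
    then show "(F_plus a b ^^ n) x \<le> real n * r + (\<bar>of_int \<lfloor>x\<rfloor>\<bar> + 3)"
      using hi[of n] unfolding funpow_F_plus_of_int by simp
  qed
  have lim: "(\<lambda>n. (F_minus a b ^^ n) x / real n) \<longlonglongrightarrow> r"
    "(\<lambda>n. (F_plus a b ^^ n) x / real n) \<longlonglongrightarrow> r" for x
    by (rule bounded_deviation_tendsto, rule *, rule *)+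
  show ?thesis
    unfolding rotation_number_def
  proof (rule the_equality)
    show "0 \<le> r \<and> r < 1 \<and> (\<forall>x. (\<lambda>n. (F_minus a b ^^ n) x / real n) \<longlonglongrightarrow> r) \<and>
        (\<forall>x. (\<lambda>n. (F_plus a b ^^ n) x / real n) \<longlonglongrightarrow> r)"
      using r lim by blast
  qed (use lim LIMSEQ_unique in blast)
qed

section \<open>Growth and continuity of \<open>rot_param\<close>\<close>

lemma rot_param_0: "rot_param a 0 = 0"
  by (simp add: rot_param_def)

lemma rot_param_1: "rot_param a 1 = 1"
proof -
  have "(\<lambda>k. a ^ k * of_int \<lceil>real (Suc k) * 1\<rceil>) sums (1 / (1 - a)\<^sup>2)"
    using geometric_deriv_sums[of a] a0 a1 by (simp add: mult.commute)
  then show ?thesis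
    using a1 by (simp add: rot_param_def sums_iff)
qed

lemma rot_param_diff_ge:
  assumes "r < s"
  shows "(1 - a)\<^sup>2 * a powr (1 / (s - r)) \<le> rot_param a s - rot_param a r"
proof -
  define d where "d k = a ^ k * of_int (\<lceil>real (Suc k) * s\<rceil> - \<lceil>real (Suc k) * r\<rceil>)" for k
  have d: "summable d" "suminf d = (\<Sum>k. a ^ k * of_int \<lceil>real (Suc k) * s\<rceil>) - (\<Sum>k. a ^ k * of_int \<lceil>real (Suc k) * r\<rceil>)"
    using summable_diff[OF summable_ceiling summable_ceiling, of s r]
      suminf_diff[OF summable_ceiling summable_ceiling, of s r]
    by (simp_all add: d_def[abs_def] algebra_simps)
  have d0: "0 \<le> d k" for k
    unfolding d_def using a0 assms
    by (intro mult_nonneg_nonneg) (auto intro!: ceiling_mono mult_left_mono)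
  \<comment> \<open>All terms \<open>d k\<close> are nonnegative, so one of them bounds the sum
    below. Index \<open>N\<close> carries the multiple \<open>N + 1\<close>, hence the subtraction
    of 1, which also keeps \<open>N\<close> below 1 / (s - r).\<close>
  define N where "N = nat \<lceil>1 / (s - r)\<rceil> - 1"
  have "1 / (s - r) > 0" using assms by simp
  then have N: "1 / (s - r) \<le> real (Suc N)" "real N \<le> 1 / (s - r)"
    unfolding N_def by linarith+
  have "1 \<le> real (Suc N) * (s - r)"
    using N(1) assms by (simp add: pos_divide_le_eq)
  then have "real (Suc N) * r + 1 \<le> real (Suc N) * s"
    by (simp add: algebra_simps)
  then have "1 \<le> \<lceil>real (Suc N) * s\<rceil> - \<lceil>real (Suc N) * r\<rceil>"
    by linarith
  then have "a ^ N * 1 \<le> d N"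
    unfolding d_def using a0 by (intro mult_left_mono) (auto simp flip: of_int_diff)
  also have "\<dots> \<le> suminf d"
    using sum_le_suminf[OF d(1), of "{N}"] d0 by simp
  finally have "a ^ N \<le> suminf d" by simp
  moreover have "a powr (1 / (s - r)) \<le> a powr real N"
    using N(2) a0 a1 by (intro powr_mono') auto
  ultimately have "a powr (1 / (s - r)) \<le> suminf d"
    using a0 by (simp add: powr_realpow)
  then have "(1 - a)\<^sup>2 * a powr (1 / (s - r)) \<le> (1 - a)\<^sup>2 * suminf d"
    by (rule mult_left_mono) simp
  then show ?thesis
    by (simp add: d(2) rot_param_def algebra_simps)
qed

lemma rot_param_strict_mono: "r < s \<Longrightarrow> rot_param a r < rot_param a s"
  using rot_param_diff_ge[of r s] a0 a1
  by (smt (verit) powr_gt_zero zero_less_power mult_pos_pos)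

text \<open>The first \<open>n\<close> terms of the difference series cancel. In a later term the
  ceilings of m r and m s lie in [0, m] with m = k + n + 1 \<le> (n + 1)(k + 1), and summing (k + 1)
  \<open>a ^ k\<close> cancels the factor \<open>(1 - a)\<^sup>2\<close>.\<close>

lemma rot_param_diff_le:
  assumes r: "0 \<le> r" "r \<le> 1" and s: "0 \<le> s" "s \<le> 1"
    and eq: "\<And>j. j \<le> n \<Longrightarrow> \<lceil>real j * r\<rceil> = \<lceil>real j * s\<rceil>"
  shows "\<bar>rot_param a r - rot_param a s\<bar> \<le> (real n + 1) * a ^ n"
proof -
  define d where "d k = a ^ k * of_int (\<lceil>real (Suc k) * r\<rceil> - \<lceil>real (Suc k) * s\<rceil>)" for k
  have d: "summable d" "suminf d = (\<Sum>k. a ^ k * of_int \<lceil>real (Suc k) * r\<rceil>) - (\<Sum>k. a ^ k * of_int \<lceil>real (Suc k) * s\<rceil>)"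
    using summable_diff[OF summable_ceiling summable_ceiling, of r s]
      suminf_diff[OF summable_ceiling summable_ceiling, of r s]
    by (simp_all add: d_def[abs_def] algebra_simps)
  have "(\<Sum>i<n. d i) = 0"
    using eq by (intro sum.neutral) (auto simp: d_def simp del: of_nat_Suc)
  then have tail: "suminf d = (\<Sum>k. d (k + n))"
    using suminf_split_initial_segment[OF d(1), of n] by simp
  have g: "(\<lambda>k. ((real n + 1) * a ^ n) * (of_nat (Suc k) * a ^ k)) sums (((real n + 1) * a ^ n) * (1 / (1 - a)\<^sup>2))"
    using geometric_deriv_sums[of a] a0 a1 by (intro sums_mult) auto
  have bd: "norm (d (k + n)) \<le> ((real n + 1) * a ^ n) * (of_nat (Suc k) * a ^ k)" for k
  proof -
    let ?m = "Suc (k + n)"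
    have "0 \<le> real ?m * x \<and> real ?m * x \<le> real ?m" if "0 \<le> x" "x \<le> 1" for x :: real
      using that by (auto intro!: mult_left_le)
    from this[OF r] this[OF s]
    have "\<bar>\<lceil>real ?m * r\<rceil> - \<lceil>real ?m * s\<rceil>\<bar> \<le> int ?m"
      by linarith
    then have "\<bar>of_int (\<lceil>real ?m * r\<rceil> - \<lceil>real ?m * s\<rceil>)\<bar> \<le> real ?m"
      by linarith
    also have "\<dots> \<le> (real n + 1) * real (Suc k)"
      by (simp add: algebra_simps)
    finally have *: "\<bar>of_int (\<lceil>real ?m * r\<rceil> - \<lceil>real ?m * s\<rceil>)\<bar> \<le> (real n + 1) * real (Suc k)" .
    have "norm (d (k + n)) = a ^ (k + n) * \<bar>of_int (\<lceil>real ?m * r\<rceil> - \<lceil>real ?m * s\<rceil>)\<bar>"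
      unfolding d_def using a0 by (simp add: abs_mult)
    also have "\<dots> \<le> a ^ (k + n) * ((real n + 1) * real (Suc k))"
      using * a0 by (intro mult_left_mono) auto
    finally show ?thesis
      by (simp add: power_add algebra_simps)
  qed
  have "norm (\<Sum>k. d (k + n)) \<le> (\<Sum>k. ((real n + 1) * a ^ n) * (of_nat (Suc k) * a ^ k))"
    using bd sums_summable[OF g] by (rule norm_suminf_le)
  then have "\<bar>suminf d\<bar> \<le> ((real n + 1) * a ^ n) / (1 - a)\<^sup>2"
    using sums_unique[OF g] tail by simp
  moreover have "rot_param a r - rot_param a s = (1 - a)\<^sup>2 * suminf d"
    by (simp add: d(2) rot_param_def algebra_simps)
  ultimately show ?thesis
    using a1 by (simp add: abs_mult field_simps)
qed

lemma tail_bound_tendsto_0: "(\<lambda>n. (real n + 1) * a ^ n) \<longlonglongrightarrow> 0"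
  using a0 a1 by real_asymp

text \<open>For a given accuracy only finitely many ceilings matter, so eventual constancy of each
  one suffices, along any filter.\<close>

lemma rot_param_tendsto:
  assumes r: "0 \<le> r" "r \<le> 1" and F: "\<forall>\<^sub>F x in F. 0 \<le> x \<and> x \<le> 1"
    and eq: "\<And>j. \<forall>\<^sub>F x in F. \<lceil>real j * x\<rceil> = \<lceil>real j * r\<rceil>"
  shows "(rot_param a \<longlongrightarrow> rot_param a r) F"
proof (rule tendstoI)
  fix e :: real assume "0 < e"
  then have "\<forall>\<^sub>F n in sequentially. (real n + 1) * a ^ n < e"
    using tail_bound_tendsto_0 by (auto dest: order_tendstoD)
  then obtain n where n: "(real n + 1) * a ^ n < e"
    by (auto simp: eventually_at_top_linorder)
  have "\<forall>\<^sub>F x in F. \<forall>j\<in>{..n}. \<lceil>real j * x\<rceil> = \<lceil>real j * r\<rceil>"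
    using eq by (intro eventually_ball_finite) auto
  with F show "\<forall>\<^sub>F x in F. dist (rot_param a x) (rot_param a r) < e"
  proof eventually_elim
    case (elim x)
    then show ?case
      using rot_param_diff_le[of x r n] r n by (auto simp: dist_real_def)
  qed
qed

lemma rot_param_left_tendsto:
  assumes "0 < r" "r \<le> 1"
  shows "(rot_param a \<longlongrightarrow> rot_param a r) (at_left r)"
proof (rule rot_param_tendsto)
  show "\<forall>\<^sub>F x in at_left r. 0 \<le> x \<and> x \<le> 1"
    using eventually_at_left_real[OF assms(1)]
    by eventually_elim (use assms in auto)
  show "\<forall>\<^sub>F x in at_left r. \<lceil>real j * x\<rceil> = \<lceil>real j * r\<rceil>" for j
  proof (cases "j = 0")
    case False
    \<comment> \<open>This is the last jump of the ceiling of \<open>real j * x\<close> strictly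
      left of \<open>r\<close>.\<close>
    then have "(of_int \<lceil>real j * r\<rceil> - 1) / real j < r"
      by (simp add: pos_divide_less_eq mult.commute) linarith
    from eventually_at_left_real[OF this] show ?thesis
    proof eventually_elim
      case (elim x)
      then have "of_int \<lceil>real j * r\<rceil> - 1 < real j * x" "real j * x \<le> real j * r"
        using False by (auto simp: pos_divide_less_eq mult.commute)
      then show ?case by linarith
    qed
  qed simp
qed (use assms in auto)

lemma rot_param_right_tendsto:
  assumes "0 \<le> r" "r < 1" "r \<notin> \<rat>"
  shows "(rot_param a \<longlongrightarrow> rot_param a r) (at_right r)"
proof (rule rot_param_tendsto)
  show "\<forall>\<^sub>F x in at_right r. 0 \<le> x \<and> x \<le> 1"
    using eventually_at_right_real[OF assms(2)]
    by eventually_elim (use assms in auto)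
  show "\<forall>\<^sub>F x in at_right r. \<lceil>real j * x\<rceil> = \<lceil>real j * r\<rceil>" for j
  proof (cases "j = 0")
    case False
    \<comment> \<open>Irrationality keeps \<open>r\<close> off the jump points, so the next jump
      lies strictly to the right.\<close>
    have "of_int \<lceil>real j * r\<rceil> / real j \<noteq> r"
      using assms(3) by (metis Rats_divide Rats_of_int Rats_of_nat)
    moreover have "r \<le> of_int \<lceil>real j * r\<rceil> / real j"
      using False by (simp add: pos_le_divide_eq mult.commute)
    ultimately have "r < of_int \<lceil>real j * r\<rceil> / real j"
      by simp
    from eventually_at_right_real[OF this] show ?thesis
    proof eventually_elim
      case (elim x)
      then have "real j * x < of_int \<lceil>real j * r\<rceil>" "real j * r \<le> real j * x"
        using False by (auto simp: pos_less_divide_eq mult.commute)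
      then show ?case by linarith
    qed
  qed simp
qed (use assms in auto)

section \<open>The exceptional set as an image of the irrationals\<close>

lemma rotation_number_rot_param:
  assumes "0 \<le> r" "r < 1"
  shows "rotation_number a (rot_param a r) = r"
  using assms by (intro rotation_number_eqI funpow_F_minus_ge funpow_F_plus_le) auto

text \<open>On a plateau of the devil's staircase the rotation number is the largest \<open>r\<close> with
  \<open>rot_param a r \<le> b\<close>; continuity of \<^const>\<open>rot_param\<close> at irrational points
  leaves no room for a plateau there.\<close>

lemma rotation_number_cases:
  assumes b: "0 \<le> b" "b < 1"
  obtains r where "0 \<le> r" "r < 1" "rotation_number a b = r" "r \<notin> \<rat> \<Longrightarrow> b = rot_param a r"
proof -
  define S where "S = {r. 0 \<le> r \<and> r \<le> 1 \<and> rot_param a r \<le> b}"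
  define r where "r = Sup S"
  have S0: "0 \<in> S" using b rot_param_0 by (simp add: S_def)
  have bdd: "bdd_above S" by (auto simp: S_def intro!: bdd_aboveI[of _ 1])
  have r0: "0 \<le> r" unfolding r_def using S0 bdd by (rule cSup_upper)
  have r1: "r \<le> 1" unfolding r_def
  proof (rule cSup_least)
    show "S \<noteq> {}" using S0 by blast
  qed (simp add: S_def)
  have below: "rot_param a x \<le> b" if xr: "x < r" for x
  proof -
    have "S \<noteq> {}" using S0 by blast
    then obtain y where "y \<in> S" "x < y"
      using less_cSupD[of S x] xr unfolding r_def by blast
    then show ?thesis
      using rot_param_strict_mono[of x y] by (auto simp: S_def)
  qed
  have above: "b < rot_param a x" if "r < x" "x \<le> 1" for x
  proof (rule ccontr)
    assume "\<not> b < rot_param a x"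
    then have "x \<in> S" using that r0 by (auto simp: S_def)
    then have "x \<le> r" unfolding r_def using bdd by (rule cSup_upper)
    with that show False by simp
  qed
  have at: "rot_param a r \<le> b"
  proof (cases "r = 0")
    case True
    then show ?thesis using b rot_param_0 by simp
  next
    case False
    then have "(rot_param a \<longlongrightarrow> rot_param a r) (at_left r)"
      using r0 r1 by (intro rot_param_left_tendsto) auto
    moreover have "\<forall>\<^sub>F x in at_left r. rot_param a x \<le> b"
      using below by (auto simp: eventually_at_filter)
    ultimately show ?thesis
      by (intro tendsto_upperbound) auto
  qed
  with b have rlt: "r < 1"
    using r1 rot_param_1 by (cases "r = 1") auto
  \<comment> \<open>On a plateau \<open>b\<close> may exceed \<open>rot_param a r\<close>, so the
    bound is taken at x > r and passed to the limit.\<close>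
  have hi: "(F_plus a b ^^ n) 0 \<le> real n * r + 1" for n
  proof (rule tendsto_lowerbound)
    show "((\<lambda>x. real n * x + 1) \<longlongrightarrow> real n * r + 1) (at_right r)"
      by (intro tendsto_intros)
    show "\<forall>\<^sub>F x in at_right r. (F_plus a b ^^ n) 0 \<le> real n * x + 1"
      using eventually_at_right_real[OF rlt]
    proof eventually_elim
      case (elim x)
      then have "b \<le> rot_param a x" using above[of x] by simp
      then show ?case by (rule funpow_F_plus_le)
    qed
  qed auto
  have "rotation_number a b = r"
    using r0 rlt funpow_F_minus_ge[OF at] hi by (rule rotation_number_eqI)
  moreover have "b = rot_param a r" if "r \<notin> \<rat>"
  proof (rule antisym)
    show "b \<le> rot_param a r"
    proof (rule tendsto_lowerbound)
      show "(rot_param a \<longlongrightarrow> rot_param a r) (at_right r)"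
        using r0 rlt that by (rule rot_param_right_tendsto)
      show "\<forall>\<^sub>F x in at_right r. b \<le> rot_param a x"
        using eventually_at_right_real[OF rlt]
      proof eventually_elim
        case (elim x)
        then show ?case using above[of x] by simp
      qed
    qed auto
  qed (rule at)
  ultimately show ?thesis
    using that r0 rlt by blast
qed

lemma irrational_rotation_set_eq:
  "irrational_rotation_set a = rot_param a ` ({0..<1} - \<rat>)"
proof (intro equalityI subsetI)
  fix b assume "b \<in> irrational_rotation_set a"
  then have "0 \<le> b" "b < 1" "rotation_number a b \<notin> \<rat>"
    by (auto simp: irrational_rotation_set_def)
  then show "b \<in> rot_param a ` ({0..<1} - \<rat>)"
    by (metis rotation_number_cases DiffI atLeastLessThan_iff imageI)
next
  fix b assume "b \<in> rot_param a ` ({0..<1} - \<rat>)"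
  then obtain r where r: "b = rot_param a r" "0 \<le> r" "r < 1" "r \<notin> \<rat>"
    by auto
  moreover have "0 \<le> b"
    using r rot_param_strict_mono[of 0 r] rot_param_0 by (cases "r = 0") auto
  moreover have "b < 1"
    using r rot_param_strict_mono[of r 1] rot_param_1 by simp
  ultimately show "b \<in> irrational_rotation_set a"
    by (simp add: irrational_rotation_set_def rotation_number_rot_param)
qed

end

section \<open>Hausdorff measures\<close>

lemma hausdorff_content_antimono:
  "\<delta> \<le> \<delta>' \<Longrightarrow> hausdorff_content h \<delta>' E \<le> hausdorff_content h \<delta> E"
  unfolding hausdorff_content_def by (rule Inf_superset_mono) (blast intro: order_trans)

text \<open>Contents grow as \<delta> shrinks, so the limit is a supremum: one scale already gives a
  lower bound, while an upper bound must hold at all scales.\<close>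

lemma hausdorff_measure_eq_SUP:
  "hausdorff_measure h E = (SUP \<delta>\<in>{0<..}. hausdorff_content h \<delta> E)"
  unfolding hausdorff_measure_def
proof (rule tendsto_Lim)
  let ?S = "SUP \<delta>\<in>{0<..}. hausdorff_content h \<delta> E"
  show "((\<lambda>\<delta>. hausdorff_content h \<delta> E) \<longlongrightarrow> ?S) (at_right 0)"
  proof (rule order_tendstoI)
    fix y assume "y < ?S"
    then obtain d where d: "d > 0" "y < hausdorff_content h d E"
      by (auto simp: less_SUP_iff)
    show "\<forall>\<^sub>F \<delta> in at_right 0. y < hausdorff_content h \<delta> E"
      using eventually_at_right_real[OF d(1)]
    proof eventually_elim
      case (elim \<delta>)
      then have "hausdorff_content h d E \<le> hausdorff_content h \<delta> E"
        by (intro hausdorff_content_antimono) auto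
      with d(2) show ?case by simp
    qed
  next
    fix y assume y: "?S < y"
    show "\<forall>\<^sub>F \<delta> in at_right 0. hausdorff_content h \<delta> E < y"
      using eventually_at_right_less[of 0]
      by eventually_elim (rule le_less_trans[OF SUP_upper y], simp)
  qed
qed simp

lemma hausdorff_content_le_card_mult:
  assumes E: "E \<subseteq> (\<Union>i<N. U i)"
    and U: "\<And>i. i < N \<Longrightarrow> bounded (U i) \<and> diameter (U i) \<le> \<delta>"
    and h: "\<And>t. 0 < t \<Longrightarrow> t \<le> \<delta> \<Longrightarrow> h t \<le> H" and "0 \<le> \<delta>" "0 \<le> H"
  shows "hausdorff_content h \<delta> E \<le> ennreal (real N * H)"
proof -
  \<comment> \<open>Empty sets have diameter 0 and contribute 0 to the sum.\<close>
  define V where "V k = (if k < N then U k else {})" for k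
  let ?g = "\<lambda>k. if diameter (V k) = 0 then 0 else ennreal (h (diameter (V k)))"
  have "hausdorff_content h \<delta> E \<le> (\<Sum>k. ?g k)"
    unfolding hausdorff_content_def
  proof (rule Inf_lower, intro CollectI exI conjI allI)
    show "E \<subseteq> (\<Union>k. V k)" using E by (force simp: V_def)
  qed (use U \<open>0 \<le> \<delta>\<close> in \<open>auto simp: V_def\<close>)
  also have "\<dots> = (\<Sum>k<N. ?g k)"
    by (rule suminf_finite) (auto simp: V_def)
  also have "\<dots> \<le> (\<Sum>k<N. ennreal H)"
  proof (rule sum_mono)
    fix k assume "k \<in> {..<N}"
    then have "bounded (V k)" "diameter (V k) \<le> \<delta>"
      using U by (auto simp: V_def)
    moreover have "0 \<le> diameter (V k)"
      using \<open>bounded (V k)\<close> by (rule diameter_ge_0)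
    ultimately show "?g k \<le> ennreal H"
      using h[of "diameter (V k)"] by (auto intro: ennreal_leI)
  qed
  also have "\<dots> = ennreal (real N * H)"
    using \<open>0 \<le> H\<close> by (simp add: ennreal_mult ennreal_of_nat_eq_real_of_nat)
  finally show ?thesis .
qed

section \<open>Upper bounds from explicit covers\<close>

text \<open>Since each \<open>r \<mapsto> \<lceil>j r\<rceil>\<close> is monotone, the vector \<open>(\<lceil>j r\<rceil>)\<^sub>j\<^sub>\<le>\<^sub>n\<close> is determined by the
  sum of its entries, which takes at most \<open>n\<^sup>2 + 1\<close> values.\<close>

lemma hausdorff_content_irrational_rotation_set_le:
  fixes a :: real and n :: nat
  defines "\<delta> \<equiv> (real n + 1) * a ^ n"
  assumes a: "0 < a" "a < 1"
    and h: "\<And>t. 0 < t \<Longrightarrow> t \<le> \<delta> \<Longrightarrow> h t \<le> h \<delta>" and "0 \<le> h \<delta>"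
  shows "hausdorff_content h \<delta> (irrational_rotation_set a) \<le> ennreal ((real n ^ 2 + 1) * h \<delta>)"
proof -
  define s where "s r = nat (\<Sum>j\<le>n. \<lceil>real j * r\<rceil>)" for r :: real
  define U where "U i = rot_param a ` {r\<in>{0..<1}. s r = i}" for i
  have d0: "0 \<le> \<delta>" using a by (simp add: \<delta>_def)
  have eq: "\<lceil>real j * x\<rceil> = \<lceil>real j * y\<rceil>"
    if xy: "0 \<le> x" "x \<le> y" "s x = s y" and "j \<le> n" for x y j
  proof (rule ccontr)
    assume ne: "\<lceil>real j * x\<rceil> \<noteq> \<lceil>real j * y\<rceil>"
    have le: "\<lceil>real i * x\<rceil> \<le> \<lceil>real i * y\<rceil>" for i
      using xy by (intro ceiling_mono mult_left_mono) auto
    have "(\<Sum>j\<le>n. \<lceil>real j * x\<rceil>) < (\<Sum>j\<le>n. \<lceil>real j * y\<rceil>)"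
      using le ne \<open>j \<le> n\<close> by (intro sum_strict_mono_ex1) (auto simp: order.strict_iff_order)
    \<comment> \<open>Nonnegativity is what makes \<open>nat\<close> preserve the strict inequality
      of the sums.\<close>
    moreover have "0 \<le> (\<Sum>j\<le>n. \<lceil>real j * x\<rceil>)"
    proof (rule sum_nonneg)
      fix j
      have "0 \<le> real j * x" using xy by simp
      then show "0 \<le> \<lceil>real j * x\<rceil>" by linarith
    qed
    ultimately show False
      using xy(3) by (simp add: s_def)
  qed
  have diff: "norm (p - q) \<le> \<delta>" if "p \<in> U i" "q \<in> U i" for p q i
  proof -
    obtain x where x: "p = rot_param a x" "0 \<le> x" "x \<le> 1" "s x = i"
      using \<open>p \<in> U i\<close> by (force simp: U_def)
    obtain y where y: "q = rot_param a y" "0 \<le> y" "y \<le> 1" "s y = i"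
      using \<open>q \<in> U i\<close> by (force simp: U_def)
    have sxy: "s x = s y" using x y by simp
    have "\<lceil>real j * x\<rceil> = \<lceil>real j * y\<rceil>" if "j \<le> n" for j
    proof (cases "x \<le> y")
      case True
      show ?thesis by (rule eq[OF x(2) True sxy that])
    next
      case False
      then show ?thesis
        using eq[OF y(2) _ sxy[symmetric] that] by simp
    qed
    then show ?thesis
      using rot_param_diff_le[OF a x(2,3) y(2,3)] unfolding x(1) y(1) \<delta>_def by simp
  qed
  have "hausdorff_content h \<delta> (irrational_rotation_set a) \<le> ennreal (real (n\<^sup>2 + 1) * h \<delta>)"
  proof (rule hausdorff_content_le_card_mult[where U = U])
    show "irrational_rotation_set a \<subseteq> (\<Union>i<n\<^sup>2 + 1. U i)"
    proof
      fix b assume "b \<in> irrational_rotation_set a"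
      then obtain r where r: "b = rot_param a r" "0 \<le> r" "r < 1"
        using irrational_rotation_set_eq[OF a] by auto
      have "(\<Sum>j\<le>n. \<lceil>real j * r\<rceil>) \<le> (\<Sum>j\<le>n. int j)"
      proof (rule sum_mono)
        fix j
        have "real j * r \<le> real j" using r by (intro mult_left_le) auto
        then show "\<lceil>real j * r\<rceil> \<le> int j" by linarith
      qed
      \<comment> \<open>Dropping j = 0 leaves \<open>n\<close> terms of size at most
        \<open>n\<close>, giving n * n instead of (n + 1) * n.\<close>
      also have "\<dots> = (\<Sum>j=1..n. int j)"
        by (rule sum.mono_neutral_right) auto
      also have "\<dots> \<le> (\<Sum>j=1..n. int n)"
        by (intro sum_mono) auto
      finally have "s r < n\<^sup>2 + 1"
        by (simp add: s_def power2_eq_square nat_le_iff less_Suc_eq_le)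
      then show "b \<in> (\<Union>i<n\<^sup>2 + 1. U i)"
        using r by (auto simp: U_def)
    qed
    show "bounded (U i) \<and> diameter (U i) \<le> \<delta>" for i
    proof
      show "bounded (U i)"
        unfolding bounded_two_points using diff by (auto simp: dist_norm)
      show "diameter (U i) \<le> \<delta>"
        using diff d0 by (intro diameter_le) auto
    qed
  qed (use d0 assms in auto)
  then show ?thesis by (simp add: add.commute)
qed

text \<open>The covers at scale (n + 1) \<open>a ^ n\<close> have cost at most the sequence in
  \<open>lim\<close>, and this scale tends to 0. Monotonicity of \<open>h\<close> is asked only
  below 1 because the logarithmic gauges blow up there.\<close>

lemma hausdorff_measure_irrational_rotation_set_le:
  fixes a :: real
  assumes a: "0 < a" "a < 1"
    and h: "\<And>s t. 0 < s \<Longrightarrow> s \<le> t \<Longrightarrow> t < 1 \<Longrightarrow> h s \<le> h t" "\<And>t. 0 \<le> h t"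
    and lim: "(\<lambda>n. (real n ^ 2 + 1) * h ((real n + 1) * a ^ n)) \<longlonglongrightarrow> l"
  shows "hausdorff_measure h (irrational_rotation_set a) \<le> ennreal l"
  unfolding hausdorff_measure_eq_SUP
proof (rule SUP_least)
  fix \<delta> :: real assume "\<delta> \<in> {0<..}"
  then have "\<forall>\<^sub>F n in sequentially. (real n + 1) * a ^ n < min \<delta> 1"
    by (intro order_tendstoD[OF tail_bound_tendsto_0[OF a]]) auto
  then have "\<forall>\<^sub>F n in sequentially. hausdorff_content h \<delta> (irrational_rotation_set a)
      \<le> ennreal ((real n ^ 2 + 1) * h ((real n + 1) * a ^ n))"
  proof eventually_elim
    case (elim n)
    have "hausdorff_content h \<delta> (irrational_rotation_set a)
        \<le> hausdorff_content h ((real n + 1) * a ^ n) (irrational_rotation_set a)"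
      using elim by (intro hausdorff_content_antimono) auto
    also have "\<dots> \<le> ennreal ((real n ^ 2 + 1) * h ((real n + 1) * a ^ n))"
      using elim h by (intro hausdorff_content_irrational_rotation_set_le a) auto
    finally show ?case .
  qed
  then show "hausdorff_content h \<delta> (irrational_rotation_set a) \<le> ennreal l"
    using lim by (intro tendsto_lowerbound[OF tendsto_ennrealI]) auto
qed

text \<open>The interval from infimum to supremum works. A measurable hull is needed because
  covering sets, and so their preimages, are arbitrary.\<close>

lemma real_set_outer_measure_le:
  fixes S :: "real set"
  assumes "\<And>x y. x \<in> S \<Longrightarrow> y \<in> S \<Longrightarrow> y - x \<le> d" "0 \<le> d"
  obtains J where "J \<in> sets lborel" "S \<subseteq> J" "emeasure lborel J \<le> ennreal d"
proof (cases "S = {}")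
  case True
  then show ?thesis using that[of "{}"] by auto
next
  case False
  then obtain z where z: "z \<in> S" by auto
  have "z - d \<le> x \<and> x \<le> z + d" if "x \<in> S" for x
    using assms(1)[OF z that] assms(1)[OF that z] by auto
  then have bdd: "bdd_below S" "bdd_above S"
    by (auto intro!: bdd_belowI[of _ "z - d"] bdd_aboveI[of _ "z + d"])
  have *: "Sup S \<le> x + d" if "x \<in> S" for x
    using assms(1)[OF that] z by (intro cSup_least) (auto simp: algebra_simps)
  have "Sup S - d \<le> Inf S"
    using * z by (intro cInf_greatest) (auto simp: algebra_simps)
  moreover have "Inf S \<le> Sup S"
    using z bdd by (meson cInf_lower cSup_upper order_trans)
  ultimately show ?thesis
    using bdd by (intro that[of "{Inf S..Sup S}"]) (auto intro: cInf_lower cSup_upper ennreal_leI)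
qed

text \<open>Mass distribution principle for the image under \<^const>\<open>rot_param\<close> of Lebesgue measure.\<close>

lemma hausdorff_measure_irrational_rotation_set_pos:
  fixes a :: real
  assumes a: "0 < a" "a < 1"
  shows "hausdorff_measure (\<lambda>t. 1 / \<bar>ln t\<bar>) (irrational_rotation_set a) > 0"
proof -
  define L where "L = - ln a"
  have L: "L > 0" using a by (simp add: L_def)
  \<comment> \<open>For t \<le> \<delta> the factor \<open>(1 - a)\<^sup>2\<close> of
    \<open>rot_param_diff_ge\<close> is at least the square root of t, so it costs only a factor 2
    in \<open>gap\<close>.\<close>
  define \<delta> where "\<delta> = (1 - a) ^ 4"
  have \<delta>: "0 < \<delta>" "\<delta> < 1" using a by (auto simp: \<delta>_def power_less_one_iff)
  have gap: "s - r \<le> 2 * L * (1 / \<bar>ln t\<bar>)"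
    if "r < s" "rot_param a s - rot_param a r \<le> t" "t \<le> \<delta>" for r s t
  proof -
    have pos: "0 < (1 - a)\<^sup>2 * a powr (1 / (s - r))" using a by simp
    have le: "(1 - a)\<^sup>2 * a powr (1 / (s - r)) \<le> t"
      using rot_param_diff_ge[OF a that(1)] that(2) by linarith
    have t: "0 < t" "t < 1" using pos le that(3) \<delta> by linarith+
    have "ln ((1 - a)\<^sup>2 * a powr (1 / (s - r))) \<le> ln t"
      using pos le t by simp
    then have 1: "2 * ln (1 - a) - L / (s - r) \<le> ln t"
      using a by (simp add: ln_mult ln_powr ln_realpow L_def)
    have "ln t \<le> ln \<delta>" using t that(3) \<delta> by simp
    then have 2: "ln t \<le> 4 * ln (1 - a)"
      using a by (simp add: \<delta>_def ln_realpow)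
    have "ln t < 0" using t by simp
    with 1 2 have "\<bar>ln t\<bar> \<le> 2 * (L / (s - r))" by linarith
    then have "\<bar>ln t\<bar> * (s - r) \<le> 2 * L"
      using that(1) by (simp add: field_simps)
    then show ?thesis
      using \<open>ln t < 0\<close> by (simp add: field_simps)
  qed
  have "ennreal (1 / (2 * L)) \<le> hausdorff_content (\<lambda>t. 1 / \<bar>ln t\<bar>) \<delta> (irrational_rotation_set a)"
    unfolding hausdorff_content_def
  proof (rule Inf_greatest, clarify)
    fix U :: "nat \<Rightarrow> real set"
    assume cov: "irrational_rotation_set a \<subseteq> (\<Union>k. U k)"
      and U: "\<forall>k. bounded (U k) \<and> diameter (U k) \<le> \<delta>"
    define g where "g k = (if diameter (U k) = 0 then 0 else 1 / \<bar>ln (diameter (U k))\<bar>)" for k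
    have g0: "0 \<le> g k" for k by (simp add: g_def)
    have "\<exists>J. J \<in> sets lborel \<and> rot_param a -` U k \<subseteq> J \<and> emeasure lborel J \<le> ennreal (2 * L * g k)" for k
    proof (rule real_set_outer_measure_le)
      fix x y assume xy: "x \<in> rot_param a -` U k" "y \<in> rot_param a -` U k"
      show "y - x \<le> 2 * L * g k"
      proof (cases "x < y")
        case True
        have "dist (rot_param a y) (rot_param a x) \<le> diameter (U k)"
          using U xy by (intro diameter_bounded_bound) auto
        then have *: "rot_param a y - rot_param a x \<le> diameter (U k)"
          by (simp add: dist_real_def)
        \<comment> \<open>Two distinct points in the preimage exclude the default value 0 of
          \<open>g k\<close>.\<close>
        then have "diameter (U k) > 0"
          using rot_param_strict_mono[OF a True] by linarith
        then show ?thesis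
          using gap[OF True *] U by (simp add: g_def)
      next
        case False
        then show ?thesis using L g0[of k] by (smt (verit) mult_nonneg_nonneg)
      qed
    qed (use L g0 in auto)
    then obtain J where J: "\<And>k. J k \<in> sets lborel" "\<And>k. rot_param a -` U k \<subseteq> J k"
      "\<And>k. emeasure lborel (J k) \<le> ennreal (2 * L * g k)"
      by metis
    have "{0..<1} - \<rat> \<subseteq> (\<Union>k. J k)"
      using cov J(2) unfolding irrational_rotation_set_eq[OF a] by blast
    moreover have "\<rat> \<in> null_sets (lborel :: real measure)"
      using countable_rat by (rule countable_imp_null_set_lborel)
    then have "emeasure lborel ({0..<1::real} - \<rat>) = 1"
      by (subst emeasure_Diff_null_set) auto
    ultimately have "1 \<le> emeasure lborel (\<Union>k. J k)"
      using J(1) by (metis emeasure_mono sets.countable_UN image_subset_iff)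
    also have "\<dots> \<le> (\<Sum>k. emeasure lborel (J k))"
      using J(1) by (intro emeasure_subadditive_countably) auto
    also have "\<dots> \<le> (\<Sum>k. ennreal (2 * L) * ennreal (g k))"
      using J(3) L g0 by (intro suminf_le) (auto simp: ennreal_mult)
    \<comment> \<open>The preimage hulls have total length at least 1 and at most 2 L times the
      gauge sum; dividing by 2 L gives the claim.\<close>
    finally have "ennreal (1 / (2 * L)) * 1 \<le> ennreal (1 / (2 * L)) * (ennreal (2 * L) * (\<Sum>k. ennreal (g k)))"
      by (intro mult_left_mono) auto
    also have "\<dots> = (\<Sum>k. ennreal (g k))"
      using L by (simp add: mult.assoc[symmetric] ennreal_mult[symmetric])
    finally show "ennreal (1 / (2 * L)) \<le>
        (\<Sum>k. if diameter (U k) = 0 then 0 else ennreal (1 / \<bar>ln (diameter (U k))\<bar>))"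
      by (simp add: g_def if_distrib cong: if_cong)
  qed
  also have "\<dots> \<le> hausdorff_measure (\<lambda>t. 1 / \<bar>ln t\<bar>) (irrational_rotation_set a)"
    unfolding hausdorff_measure_eq_SUP using \<delta> by (intro SUP_upper) simp
  finally have "ennreal (1 / (2 * L)) \<le> hausdorff_measure (\<lambda>t. 1 / \<bar>ln t\<bar>) (irrational_rotation_set a)" .
  moreover have "0 < ennreal (1 / (2 * L))" using L by simp
  ultimately show ?thesis by (rule less_le_trans[rotated])
qed

theorem theorem7p1:
  fixes a :: real
  assumes "0 < a" and "a < 1"
  shows "hausdorff_dim (irrational_rotation_set a) = 0 \<and>
         hausdorff_measure (\<lambda>t. 1 / \<bar>ln t\<bar> ^ 2) (irrational_rotation_set a) < \<infinity> \<and>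
         hausdorff_measure (\<lambda>t. 1 / \<bar>ln t\<bar>) (irrational_rotation_set a) > 0"
proof (intro conjI)
  have zero: "hausdorff_measure (\<lambda>t. t powr s) (irrational_rotation_set a) = 0" if "s > 0" for s
  proof -
    have "(\<lambda>n. (real n ^ 2 + 1) * ((real n + 1) * a ^ n) powr s) \<longlonglongrightarrow> 0"
      using assms that by real_asymp
    then have "hausdorff_measure (\<lambda>t. t powr s) (irrational_rotation_set a) \<le> ennreal 0"
      using assms that
      by (intro hausdorff_measure_irrational_rotation_set_le) (auto intro: powr_mono2)
    then show ?thesis by simp
  qed
  have "hausdorff_dim (irrational_rotation_set a) \<le> 0 + ennreal s" if "s > 0" for s
    unfolding hausdorff_dim_def
  proof (rule Inf_lower, intro CollectI exI conjI)
    show "0 + ennreal s = ennreal s" by simp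
  qed (use that zero in auto)
  then have "hausdorff_dim (irrational_rotation_set a) \<le> 0"
    by (rule ennreal_le_epsilon)
  then show "hausdorff_dim (irrational_rotation_set a) = 0" by simp
next
  \<comment> \<open>The logarithm is asymptotic to n \<open>ln a\<close>, so the quadratic number of
    covering sets is exactly balanced by the gauge.\<close>
  have "(\<lambda>n. (real n ^ 2 + 1) * (1 / \<bar>ln ((real n + 1) * a ^ n)\<bar> ^ 2)) \<longlonglongrightarrow> inverse ((ln a)\<^sup>2)"
    using assms by real_asymp
  moreover have "1 / \<bar>ln s\<bar> ^ 2 \<le> 1 / \<bar>ln t\<bar> ^ 2" if "0 < s" "s \<le> t" "t < 1" for s t :: real
  proof -
    have "ln t < 0" "ln s \<le> ln t" using that by auto
    then show ?thesis by (intro divide_left_mono power_mono) auto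
  qed
  ultimately have "hausdorff_measure (\<lambda>t. 1 / \<bar>ln t\<bar> ^ 2) (irrational_rotation_set a)
      \<le> ennreal (inverse ((ln a)\<^sup>2))"
    using assms by (intro hausdorff_measure_irrational_rotation_set_le) auto
  also have "\<dots> < \<infinity>" by simp
  finally show "hausdorff_measure (\<lambda>t. 1 / \<bar>ln t\<bar> ^ 2) (irrational_rotation_set a) < \<infinity>" .
next
  show "hausdorff_measure (\<lambda>t. 1 / \<bar>ln t\<bar>) (irrational_rotation_set a) > 0"
    using assms by (rule hausdorff_measure_irrational_rotation_set_pos)
qed

end
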